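(* Let $K\geq 1$ be an integer. For every integer $m>1$ there exists an integer $N\geq 0$ such that either $\pi_K^N(m)$ is a fixed point of $\pi_K$ (i.e. $\pi_K(\pi_K^N(m))=\pi_K^N(m)$), or $K\equiv 3\pmod 6$ and $\pi_K^N(m)\in\{2,3\}$. Moreover, when $K\equiv 3 \pmod 6$, one has $\pi_K(2)=3$ and $\pi_K(3)=2$, so $(2,3)$ is a $2$-periodic point.
   Context: For a positive integer $K$, the $K$-Fibonacci sequence is defined by $F_{K,0}=0$, $F_{K,1}=1$, $F_{K,n}=K F_{K,n-1}+F_{K,n-2}$. For an integer $m>1$ this sequence is periodic modulo $m$, and $\pi_K(m)$ denotes the length of its shortest period modulo $m$ (the $K$-Pisano period). Iterates are $\pi_K^1=\pi_K$, $\pi_K^{i+1}(m)=\pi_K(\pi_K^{i}(m))$, and $\pi_K^0(m)=m$. A fixed point is an integer $m>1$ with $\pi_K(m)=m$. *)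

theory Defs
  imports "HOL-Number_Theory.Cong"
begin

fun kfib :: "nat \<Rightarrow> nat \<Rightarrow> nat" where
  "kfib K 0 = 0"
| "kfib K (Suc 0) = 1"
| "kfib K (Suc (Suc n)) = K * kfib K (Suc n) + kfib K n"

definition is_period_mod :: "nat \<Rightarrow> nat \<Rightarrow> nat \<Rightarrow> bool" where
  "is_period_mod K m p \<longleftrightarrow> p > 0 \<and> (\<forall>n. [kfib K (n + p) = kfib K n] (mod m))"

text \<open>The sequence modulo \<open>m\<close> is purely periodic for every \<open>m > 1\<close> (its recurrence can be
  run backwards), so periods are taken from index 0 on and the minimum below exists.\<close>

definition pisano :: "nat \<Rightarrow> nat \<Rightarrow> nat" where
  "pisano K m = (LEAST p. is_period_mod K m p)"

definition pisano_fixed_point :: "nat \<Rightarrow> nat \<Rightarrow> bool" where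
  "pisano_fixed_point K m \<longleftrightarrow> m > 1 \<and> pisano K m = m"

definition periodic_point :: "('a \<Rightarrow> 'a) \<Rightarrow> nat \<Rightarrow> 'a \<Rightarrow> bool" where
  "periodic_point f p x \<longleftrightarrow> p > 0 \<and> (f ^^ p) x = x \<and> (\<forall>i. 0 < i \<and> i < p \<longrightarrow> (f ^^ i) x \<noteq> x)"

end

theory Submission
  imports Defs "HOL-Number_Theory.Euler_Criterion"
begin

text \<open>
  Say that \<open>n\<close> returns modulo \<open>m\<close> if \<open>F n = 0\<close> and \<open>F (n + 1) = 1\<close> modulo \<open>m\<close>; these \<open>n\<close> are the
  multiples of the Pisano period. If \<open>n\<close> returns modulo \<open>m\<close> and \<open>d\<close> divides \<open>m\<close>, then \<open>d n\<close> returns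
  modulo \<open>d m\<close>, so everything is controlled by the periods of primes. By the Frobenius identity in
  \<open>\<int>[\<surd>D]\<close>, \<open>D = K\<^sup>2 + 4\<close>, the period of an odd prime \<open>p\<close> divides \<open>p - 1\<close> or \<open>2 (p + 1)\<close> if \<open>p\<close> does
  not divide \<open>D\<close>, and \<open>4 p\<close> otherwise.

  Call \<open>2\<close>, the divisors of \<open>D\<close>, and \<open>3\<close> for odd \<open>K\<close> tame. The wild part of the iterates strictly
  decreases until only tame primes are left. From there a few more steps lead to the class of
  numbers that are divisible by the necessary powers of \<open>2\<close> and \<open>3\<close>, or else to \<open>2\<close> or \<open>3\<close> when
  \<open>K = 3\<close> modulo \<open>6\<close>. On that class, which is closed under the period map, the period of \<open>m\<close>
  divides \<open>m\<close>; hence the iterates become constant.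
\<close>

section \<open>Return times\<close>

text \<open>Equivalently, the \<open>n\<close>-th power of the companion matrix is the identity
  modulo \<open>m\<close>. Integers are used because -1 and differences occur throughout.\<close>

definition returns_mod :: "nat \<Rightarrow> nat \<Rightarrow> nat \<Rightarrow> bool" where
  "returns_mod K m n \<longleftrightarrow>
     [int (kfib K n) = 0] (mod int m) \<and> [int (kfib K (Suc n)) = 1] (mod int m)"

lemma returns_mod_iff_dvd:
  "returns_mod K m n \<longleftrightarrow> int m dvd int (kfib K n) \<and> int m dvd int (kfib K (Suc n)) - 1"
  by (simp add: returns_mod_def cong_iff_dvd_diff)

text \<open>These are entries of a product of two powers of the companion matrix, with the
  predecessor of \<open>F a\<close> written as \<open>F (a + 1) - K F a\<close> so that no index
  \<open>a - 1\<close> occurs.\<close>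

lemma kfib_add:
  "int (kfib K (a + b)) = int (kfib K a) * int (kfib K (Suc b))
     + int (kfib K (Suc a)) * int (kfib K b) - int K * int (kfib K a) * int (kfib K b)"
  "int (kfib K (Suc (a + b))) =
     int (kfib K (Suc a)) * int (kfib K (Suc b)) + int (kfib K a) * int (kfib K b)"
  by (induction a) (simp_all add: algebra_simps)

text \<open>The left side is the determinant of the \<open>n\<close>-th power of the companion
  matrix, whose own determinant is -1.\<close>

lemma kfib_cassini:
  "int (kfib K (Suc n)) ^ 2 - int K * int (kfib K (Suc n)) * int (kfib K n) - int (kfib K n) ^ 2
     = (- 1) ^ n"
proof (induction n)
  case (Suc n)
  show ?case
    unfolding power_Suc Suc[symmetric] by (simp add: algebra_simps power2_eq_square)
qed simp

lemma returns_mod_0: "returns_mod K m 0"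
  by (simp add: returns_mod_def)

lemma returns_mod_1: "returns_mod K 1 n"
  by (simp add: returns_mod_def)

lemma returns_mod_shift:
  assumes "returns_mod K m p"
  shows "[int (kfib K (p + n)) = int (kfib K n)] (mod int m)"
proof -
  have "[int (kfib K (p + n)) = 0 * int (kfib K (Suc n)) + 1 * int (kfib K n)
      - int K * 0 * int (kfib K n)] (mod int m)"
    unfolding kfib_add
    using assms unfolding returns_mod_def
    by (intro cong_add cong_diff cong_mult cong_refl) auto
  then show ?thesis by simp
qed

lemma returns_mod_add_iff:
  assumes "returns_mod K m p"
  shows "returns_mod K m (p + n) \<longleftrightarrow> returns_mod K m n"
  using returns_mod_shift[OF assms, of n] returns_mod_shift[OF assms, of "Suc n"]
  unfolding returns_mod_def by (metis add_Suc_right cong_sym cong_trans)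

lemma returns_mod_mult:
  assumes "returns_mod K m p"
  shows "returns_mod K m (j * p)"
  by (induction j) (simp_all add: returns_mod_0 returns_mod_add_iff[OF assms])

lemma returns_mod_dvd:
  "\<lbrakk>returns_mod K m p; p dvd n\<rbrakk> \<Longrightarrow> returns_mod K m n"
  using returns_mod_mult by (metis dvd_def mult.commute)

lemma returns_mod_divisor:
  "\<lbrakk>returns_mod K m p; d dvd m\<rbrakk> \<Longrightarrow> returns_mod K d p"
  unfolding returns_mod_iff_dvd by (meson dvd_trans int_dvd_int_iff)

text \<open>Two consecutive terms determine all later ones, so agreement at the indices 0 and 1
  suffices.\<close>

lemma is_period_mod_iff:
  "is_period_mod K m p \<longleftrightarrow> p > 0 \<and> returns_mod K m p"
proof
  assume p: "is_period_mod K m p"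
  then have "[kfib K (n + p) = kfib K n] (mod m)" for n
    by (simp add: is_period_mod_def)
  from this[of 0] this[of 1] p show "p > 0 \<and> returns_mod K m p"
    unfolding returns_mod_def is_period_mod_def
    by (auto simp flip: cong_int_iff)
next
  assume "p > 0 \<and> returns_mod K m p"
  then show "is_period_mod K m p"
    using returns_mod_shift[of K m p]
    by (auto simp: is_period_mod_def add.commute simp flip: cong_int_iff)
qed

section \<open>Lifting return times to multiples and gluing them over coprime moduli\<close>

lemma dvd_diff_iff_ex:
  fixes a b c :: "'a :: comm_ring_1"
  shows "a dvd b - c \<longleftrightarrow> (\<exists>k. b = c + a * k)"
  unfolding dvd_def by (simp add: diff_eq_eq add.commute)

text \<open>If the matrix power is \<open>I + m B\<close>, then its \<open>d\<close>-th power is \<open>I + d m B\<close> modulo \<open>m\<^sup>2\<close>.\<close>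

lemma returns_mod_lift:
  assumes "returns_mod K m n" and "d dvd m"
  shows "returns_mod K (d * m) (d * n)"
proof -
  let ?M = "int m"
  obtain x where x: "int (kfib K n) = ?M * x"
    using assms unfolding returns_mod_iff_dvd by (meson dvdE)
  obtain y where y: "int (kfib K (Suc n)) = 1 + ?M * y"
    using assms(1) unfolding returns_mod_iff_dvd dvd_diff_iff_ex by blast
  have "?M ^ 2 dvd int (kfib K (j * n)) - int j * ?M * x \<and>
        ?M ^ 2 dvd int (kfib K (Suc (j * n))) - (1 + int j * ?M * y)" for j
  proof (induction j)
    case (Suc j)
    then obtain u v where u: "int (kfib K (j * n)) = int j * ?M * x + ?M ^ 2 * u"
      and v: "int (kfib K (Suc (j * n))) = 1 + int j * ?M * y + ?M ^ 2 * v"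
    unfolding dvd_diff_iff_ex by blast
    have "int (kfib K (Suc j * n)) - int (Suc j) * ?M * x
        = ?M ^ 2 * (int j * x * y + u + ?M * u * y + int j * x * y + v * ?M * x
             - int K * x * (int j * x + ?M * u))"
      unfolding mult_Suc kfib_add u v x y
      by (simp add: algebra_simps power2_eq_square)
    moreover have "int (kfib K (Suc (Suc j * n))) - (1 + int (Suc j) * ?M * y)
        = ?M ^ 2 * (v + int j * y * y + ?M * v * y + int j * x * x + ?M * u * x)"
      unfolding mult_Suc kfib_add u v x y
      by (simp add: algebra_simps power2_eq_square)
    ultimately show ?case by (metis dvd_triv_left)
  qed simp
  from this[of d] obtain u v where u: "int (kfib K (d * n)) = int d * ?M * x + ?M ^ 2 * u"
      and v: "int (kfib K (Suc (d * n))) = 1 + int d * ?M * y + ?M ^ 2 * v"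
    unfolding dvd_diff_iff_ex by blast
  \<comment> \<open>This is where \<open>d dvd m\<close> enters: the remainders, multiples of the
    square of \<open>m\<close>, vanish modulo \<open>d * m\<close>, as do the linear terms.\<close>
  have "int (d * m) dvd ?M ^ 2"
    using assms(2) by (metis int_dvd_int_iff mult_dvd_mono dvd_refl of_nat_mult power2_eq_square)
  then show ?thesis
    unfolding returns_mod_iff_dvd u v by (simp add: dvd_add)
qed

lemma returns_mod_coprime:
  assumes "returns_mod K a n" "returns_mod K b n" "coprime a b"
  shows "returns_mod K (a * b) n"
  using assms unfolding returns_mod_iff_dvd of_nat_mult
  by (meson divides_mult coprime_int_iff)

text \<open>A repeated prime costs a factor \<open>p\<close> by lifting. For a new prime the Chinese
  remainder theorem applies, and the common multiple \<open>c * n\<close> is good enough.\<close>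

lemma returns_mod_prime_step:
  assumes "prime p" "returns_mod K p c" "returns_mod K m n"
  shows "returns_mod K (p * m) (if p dvd m then p * n else c * n)"
proof (cases "p dvd m")
  case True
  then show ?thesis using returns_mod_lift assms by simp
next
  case False
  then have "coprime p m" using assms(1) by (simp add: prime_imp_coprime)
  moreover have "returns_mod K p (c * n)" "returns_mod K m (c * n)"
    by (rule returns_mod_dvd[OF assms(2)] returns_mod_dvd[OF assms(3)]; simp)+
  ultimately show ?thesis
    using False returns_mod_coprime by simp
qed

lemma returns_mod_prime_power:
  assumes "prime p" "returns_mod K p c"
  shows "returns_mod K (p ^ Suc v) (p ^ v * c)"
proof (induction v)
  case (Suc v)
  then show ?case
    using returns_mod_lift[OF Suc, of p] by (simp add: mult.assoc)
qed (use assms in simp)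

lemma returns_mod_prime_powers:
  assumes "m > 0" "\<And>p. prime p \<Longrightarrow> p dvd m \<Longrightarrow> returns_mod K (p ^ multiplicity p m) n"
  shows "returns_mod K m n"
proof -
  have *: "int m dvd x" if "\<And>p. prime p \<Longrightarrow> p dvd m \<Longrightarrow> int (p ^ multiplicity p m) dvd x" for x
  proof (cases "x = 0")
    case False
    have "m dvd nat \<bar>x\<bar>"
    proof (rule multiplicity_le_imp_dvd)
      fix p :: nat assume p: "prime p"
      show "multiplicity p m \<le> multiplicity p (nat \<bar>x\<bar>)"
      proof (cases "p dvd m")
        case True
        then have "p ^ multiplicity p m dvd nat \<bar>x\<bar>"
          using that[OF p] by simp
        then show ?thesis using False p by (intro multiplicity_geI) auto
      qed (simp add: not_dvd_imp_multiplicity_0)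
    qed (use assms in simp)
    then show ?thesis by simp
  qed simp
  show ?thesis
    unfolding returns_mod_iff_dvd by (intro conjI *; use assms(2) in \<open>simp add: returns_mod_iff_dvd\<close>)
qed

text \<open>Cassini's identity at the state (0, 1) gives \<open>(- 1) ^ n = 1\<close> modulo
  \<open>m\<close>, so an odd \<open>n\<close> would force \<open>m\<close> to divide 2.\<close>

lemma returns_mod_even:
  assumes "returns_mod K m n" "m > 2"
  shows "even n"
proof (rule ccontr)
  assume "odd n"
  have "[int (kfib K (Suc n)) ^ 2 - int K * int (kfib K (Suc n)) * int (kfib K n) - int (kfib K n) ^ 2
     = 1 ^ 2 - int K * 1 * 0 - 0 ^ 2] (mod int m)"
    using assms(1) unfolding returns_mod_def
    by (intro cong_diff cong_mult cong_pow cong_refl) auto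
  then have "[- 1 = 1] (mod int m)"
    using \<open>odd n\<close> unfolding kfib_cassini by simp
  then have "int m dvd 2" by (simp add: cong_iff_dvd_diff)
  then show False using assms(2) zdvd_imp_le by fastforce
qed

section \<open>Periods of primes\<close>

lemma discriminant_not_square:
  fixes K :: nat and c :: int
  assumes "K \<ge> 1"
  shows "c ^ 2 \<noteq> int K ^ 2 + 4"
proof
  assume c: "c ^ 2 = int K ^ 2 + 4"
  define d where "d = \<bar>c\<bar>"
  have d: "d * d = int K * int K + 4" "d \<ge> 0"
    using c by (simp_all add: d_def power2_eq_square)
  \<comment> \<open>A square root would lie strictly between \<open>K\<close> and
    \<open>K + 2\<close>; but the square of \<open>K + 1\<close> exceeds that of \<open>K\<close> by
    an odd number, not by 4.\<close>
  have "d > int K"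
  proof (rule ccontr)
    assume "\<not> d > int K"
    then have "d * d \<le> int K * int K" using d(2) by (intro mult_mono) auto
    then show False using d(1) by linarith
  qed
  moreover have "d < int K + 2"
  proof (rule ccontr)
    assume "\<not> d < int K + 2"
    then have "(int K + 2) * (int K + 2) \<le> d * d" by (intro mult_mono) auto
    then show False using d(1) assms by (simp add: algebra_simps)
  qed
  ultimately have "d = int K + 1" by linarith
  then show False using d(1) by (simp add: algebra_simps) presburger
qed

text \<open>Since the discriminant is not a square, \<open>s\<close> is irrational, and integer
  coefficients with respect to 1 and \<open>s\<close> can be compared.\<close>

lemma sqrt_discriminant_unique:
  fixes K :: nat and a b c d :: int and s :: real
  assumes "K \<ge> 1" and s: "s ^ 2 = real K ^ 2 + 4"
    and eq: "of_int a + of_int b * s = of_int c + of_int d * s"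
  shows "a = c \<and> b = d"
proof -
  have "of_int (b - d) * s = of_int (c - a)"
    using eq by (simp add: algebra_simps)
  then have "(of_int (b - d) * s) ^ 2 = (of_int (c - a)) ^ 2" by (simp only:)
  then have "real_of_int ((b - d) ^ 2 * (int K ^ 2 + 4)) = of_int ((c - a) ^ 2)"
    by (simp add: power_mult_distrib s)
  then have sq: "(b - d) ^ 2 * (int K ^ 2 + 4) = (c - a) ^ 2"
    by (simp only: of_int_eq_iff)
  have "b = d"
  proof (rule ccontr)
    assume "b \<noteq> d"
    have "(b - d) ^ 2 dvd (c - a) ^ 2" using sq by (metis dvd_triv_left)
    then have "b - d dvd c - a" by simp
    then obtain e where "c - a = (b - d) * e" by (rule dvdE)
    then have "int K ^ 2 + 4 = e ^ 2"
      using sq \<open>b \<noteq> d\<close> by (simp add: power_mult_distrib)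
    then show False using discriminant_not_square[OF assms(1)] by metis
  qed
  then show ?thesis using eq by simp
qed

text \<open>This is Binet's formula with denominators cleared: a root \<open>r = (K + s) / 2\<close>
  of the characteristic polynomial satisfies \<open>r ^ n = F n * r + F (n - 1)\<close>.\<close>

lemma kfib_power:
  fixes s :: real
  assumes s: "s ^ 2 = real K ^ 2 + 4"
  shows "2 * (real K + s) ^ n =
    2 ^ n * (2 * real (kfib K (Suc n)) - real K * real (kfib K n) + real (kfib K n) * s)"
proof (induction n)
  case (Suc n)
  have "2 * (real K + s) ^ Suc n = (real K + s) * (2 * (real K + s) ^ n)" by simp
  \<comment> \<open>The difference \<open>s ^ 2 - real K ^ 2\<close> is isolated because it equals
    4, which supplies the next power of two.\<close>
  also have "\<dots> = 2 ^ n * (2 * real K * real (kfib K (Suc n)) + 2 * real (kfib K (Suc n)) * s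
      + real (kfib K n) * (s ^ 2 - real K ^ 2))"
    unfolding Suc by (simp add: algebra_simps power2_eq_square)
  also have "\<dots> = 2 ^ Suc n * (2 * real (kfib K (Suc (Suc n))) - real K * real (kfib K (Suc n))
      + real (kfib K (Suc n)) * s)"
    unfolding s by (simp add: algebra_simps)
  finally show ?case .
qed simp

text \<open>Frobenius: the inner binomial coefficients are divisible by \<open>p\<close>, so only
  the \<open>p\<close>-th powers of \<open>k\<close> and \<open>s\<close> survive modulo
  \<open>p\<close>, and an odd power of \<open>s\<close> is a power of \<open>D\<close> times
  \<open>s\<close>.\<close>

lemma binomial_prime_sqrt:
  fixes s :: real and p :: nat and D k :: int
  assumes s: "s ^ 2 = of_int D" and "prime p" "odd p"
  shows "\<exists>a b :: int. (of_int k + s) ^ p =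
    of_int (k ^ p + int p * a) + of_int (D ^ ((p - 1) div 2) + int p * b) * s"
proof -
  \<comment> \<open>\<open>Z\<close> is the ring generated by \<open>s\<close> over the integers;
    its closure properties show that the inner terms, divided by \<open>p\<close>, still sum to an
    element of it.\<close>
  define Z where "Z = {x. \<exists>a b :: int. x = of_int a + of_int b * s}"
  have ZI: "of_int a + of_int b * s \<in> Z" for a b by (auto simp: Z_def)
  have Z_int: "of_int a \<in> Z" for a using ZI[of a 0] by simp
  have Z_s: "s \<in> Z" using ZI[of 0 1] by simp
  have Z_add: "x + y \<in> Z" if xyZ: "x \<in> Z" "y \<in> Z" for x y
  proof -
    obtain a b c d where "x = of_int a + of_int b * s" "y = of_int c + of_int d * s"
      using xyZ unfolding Z_def by blast
    then have "x + y = of_int (a + c) + of_int (b + d) * s"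
      by (simp add: algebra_simps)
    then show ?thesis using ZI by metis
  qed
  have Z_mult: "x * y \<in> Z" if xyZ: "x \<in> Z" "y \<in> Z" for x y
  proof -
    obtain a b c d where xy: "x = of_int a + of_int b * s" "y = of_int c + of_int d * s"
      using xyZ unfolding Z_def by blast
    have "x * y = of_int a * of_int c + of_int b * of_int d * s ^ 2
        + (of_int a * of_int d + of_int b * of_int c) * s"
      by (simp add: xy algebra_simps power2_eq_square)
    also have "\<dots> = of_int (a * c + b * d * D) + of_int (a * d + b * c) * s"
      by (simp add: s)
    finally show ?thesis using ZI by metis
  qed
  have Z_pow: "x ^ n \<in> Z" if "x \<in> Z" for x n
    by (induction n) (use Z_int[of 1] Z_mult that in auto)
  have Z_sum: "sum f A \<in> Z" if "\<And>i. i \<in> A \<Longrightarrow> f i \<in> Z" for f and A :: "nat set"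
    using that by (induction A rule: infinite_finite_induct) (use Z_int[of 0] Z_add in auto)
  have "p > 1" using \<open>prime p\<close> by (rule prime_gt_1_nat)
  let ?t = "\<lambda>i. of_nat (p choose i) * of_int k ^ i * s ^ (p - i)"
  have "(of_int k + s) ^ p = (\<Sum>i\<le>p. ?t i)" by (rule binomial_ring)
  also have "{..p} = insert 0 (insert p {0<..<p})" using \<open>p > 1\<close> by auto
  also have "sum ?t \<dots> = s ^ p + of_int k ^ p + (\<Sum>i\<in>{0<..<p}. ?t i)"
    using \<open>p > 1\<close> by simp
  also have "(\<Sum>i\<in>{0<..<p}. ?t i)
      = of_nat p * (\<Sum>i\<in>{0<..<p}. of_nat ((p choose i) div p) * of_int k ^ i * s ^ (p - i))"
    unfolding sum_distrib_left
  proof (rule sum.cong)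
    fix i assume "i \<in> {0<..<p}"
    then have "p dvd (p choose i)"
      using dvd_choose_prime[of i p] \<open>prime p\<close> by auto
    then have "real (p choose i) = real p * real ((p choose i) div p)"
      by (metis dvd_mult_div_cancel of_nat_mult)
    then show "?t i = of_nat p * (of_nat ((p choose i) div p) * of_int k ^ i * s ^ (p - i))"
      by simp
  qed simp
  finally have eq: "(of_int k + s) ^ p = s ^ p + of_int k ^ p
      + of_nat p * (\<Sum>i\<in>{0<..<p}. of_nat ((p choose i) div p) * of_int k ^ i * s ^ (p - i))" .
  have "(\<Sum>i\<in>{0<..<p}. of_nat ((p choose i) div p) * of_int k ^ i * s ^ (p - i)) \<in> Z"
    by (intro Z_sum Z_mult Z_pow Z_s Z_int) (use Z_int[of "int _"] in simp)
  then obtain a b where ab: "(\<Sum>i\<in>{0<..<p}. of_nat ((p choose i) div p) * of_int k ^ i * s ^ (p - i))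
      = of_int a + of_int b * s"
    unfolding Z_def by blast
  obtain h where h: "p = Suc (2 * h)" using \<open>odd p\<close> by (auto elim: oddE)
  have "s ^ p = of_int (D ^ h) * s" by (simp add: h power_mult s)
  then have "(of_int k + s) ^ p =
    of_int (k ^ p + int p * a) + of_int (D ^ ((p - 1) div 2) + int p * b) * s"
    unfolding eq ab by (simp add: h algebra_simps)
  then show ?thesis by blast
qed

text \<open>Binet's formula and the Frobenius identity give two expressions for
  \<open>(K + s) ^ p\<close>. Their coefficients are compared modulo \<open>p\<close>; Euler's
  criterion turns the power of the discriminant into \<open>l\<close>, and Fermat's theorem removes
  the other \<open>p\<close>-th powers.\<close>

lemma kfib_prime_cong:
  assumes "K \<ge> 1" "prime p" "p > 2"
  defines "l \<equiv> Legendre (int K ^ 2 + 4) (int p)"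
  shows "[int (kfib K p) = l] (mod int p)"
    and "[2 * int (kfib K (Suc p)) = int K * (1 + l)] (mod int p)"
proof -
  let ?D = "int K ^ 2 + 4" and ?F = "int (kfib K p)" and ?G = "int (kfib K (Suc p))"
  have "odd p" using assms(2,3) prime_odd_nat by auto
  define s where "s = sqrt (real K ^ 2 + 4)"
  have s: "s ^ 2 = real K ^ 2 + 4" by (simp add: s_def)
  then obtain a b where ab: "(of_int (int K) + s) ^ p =
      of_int (int K ^ p + int p * a) + of_int (?D ^ ((p - 1) div 2) + int p * b) * s"
    using binomial_prime_sqrt[of s ?D p "int K"] \<open>odd p\<close> assms(2) by auto
  have "of_int (2 * (int K ^ p + int p * a)) + of_int (2 * (?D ^ ((p - 1) div 2) + int p * b)) * s
      = 2 * (of_int (int K) + s) ^ p"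
    unfolding ab by (simp add: algebra_simps)
  also have "\<dots> = of_int (2 ^ p * (2 * ?G - int K * ?F)) + of_int (2 ^ p * ?F) * s"
    using kfib_power[OF s, of p] by (simp add: algebra_simps)
  finally have FG: "2 * (int K ^ p + int p * a) = 2 ^ p * (2 * ?G - int K * ?F)"
      "2 * (?D ^ ((p - 1) div 2) + int p * b) = 2 ^ p * ?F"
    using sqrt_discriminant_unique[OF assms(1) s] by blast+
  have fermat: "[int x ^ p = int x] (mod int p)" for x
  proof (cases "p dvd x")
    case True
    then show ?thesis using assms(3) by (simp add: cong_iff_dvd_diff dvd_diff dvd_power_le[of "int p" "int x" 1 p, simplified])
  next
    case False
    have "[x * x ^ (p - 1) = x * 1] (mod p)"
      using fermat_theorem[OF assms(2) False] by (rule cong_scalar_left)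
    moreover have "x * x ^ (p - 1) = x ^ p"
      using assms(3) by (simp flip: power_Suc)
    ultimately have "[x ^ p = x] (mod p)" by simp
    then show ?thesis by (simp flip: cong_int_iff)
  qed
  have euler: "[?D ^ ((p - 1) div 2) = l] (mod int p)"
    unfolding l_def using euler_criterion[of p ?D] assms(2,3) cong_sym by blast
  have two: "coprime 2 (int p)" using \<open>odd p\<close> by simp
  have "[2 * ?F = 2 ^ p * ?F] (mod int p)"
    using fermat[of 2] by (intro cong_mult cong_refl) (simp add: cong_sym)
  also have "2 ^ p * ?F = 2 * (?D ^ ((p - 1) div 2) + int p * b)" by (simp only: FG)
  also have "[\<dots> = 2 * (l + 0)] (mod int p)"
    by (intro cong_mult cong_add cong_refl euler) (simp add: cong_iff_dvd_diff)
  finally show F: "[?F = l] (mod int p)"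
    using two by (simp only: cong_mult_lcancel add_0_right)
  have "[2 * (2 * ?G - int K * ?F) = 2 ^ p * (2 * ?G - int K * ?F)] (mod int p)"
    using fermat[of 2] by (intro cong_mult cong_refl) (simp add: cong_sym)
  also have "2 ^ p * (2 * ?G - int K * ?F) = 2 * (int K ^ p + int p * a)" by (simp only: FG)
  also have "[\<dots> = 2 * (int K + 0)] (mod int p)"
    by (intro cong_mult cong_add cong_refl fermat) (simp add: cong_iff_dvd_diff)
  finally have "[2 * ?G - int K * ?F = int K] (mod int p)"
    using two by (simp only: cong_mult_lcancel add_0_right)
  then have "[2 * ?G - int K * ?F + int K * ?F = int K + int K * l] (mod int p)"
    by (intro cong_add cong_mult cong_refl F)
  then show "[2 * ?G = int K * (1 + l)] (mod int p)" by (simp add: algebra_simps)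
qed

text \<open>If \<open>F n\<close> vanishes, the \<open>n\<close>-th matrix power is the scalar
  \<open>c\<close>, and doubling \<open>n\<close> squares this scalar.\<close>

lemma kfib_double_cong:
  assumes "[int (kfib K n) = 0] (mod int m)" "[int (kfib K (Suc n)) = c] (mod int m)"
  shows "[int (kfib K (2 * n)) = 0] (mod int m)" "[int (kfib K (Suc (2 * n))) = c ^ 2] (mod int m)"
proof -
  have "[int (kfib K (n + n)) = 0 * c + c * 0 - int K * 0 * 0] (mod int m)"
    unfolding kfib_add by (intro cong_add cong_diff cong_mult cong_refl assms)
  then show "[int (kfib K (2 * n)) = 0] (mod int m)" by (simp add: mult_2)
  have "[int (kfib K (Suc (n + n))) = c * c + 0 * 0] (mod int m)"
    unfolding kfib_add by (intro cong_add cong_mult assms)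
  then show "[int (kfib K (Suc (2 * n))) = c ^ 2] (mod int m)"
    by (simp add: mult_2 power2_eq_square)
qed

text \<open>At index \<open>p\<close> the matrix power is the scalar \<open>K / 2\<close>, whose
  square is -1 because \<open>p\<close> divides the discriminant. Two doublings lead to the scalar
  1.\<close>

lemma returns_mod_ramified_prime:
  assumes "K \<ge> 1" "prime p" "p > 2" "p dvd K ^ 2 + 4"
  shows "returns_mod K p (4 * p)"
proof -
  have D: "int p dvd int K ^ 2 + 4"
    using assms(4) by (metis int_dvd_int_iff of_nat_add of_nat_numeral of_nat_power)
  then have "[int K ^ 2 + 4 = 0] (mod int p)" by (simp add: cong_0_iff)
  then have l: "Legendre (int K ^ 2 + 4) (int p) = 0" by (simp add: Legendre_def)
  let ?c = "int (kfib K (Suc p))"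
  have F: "[int (kfib K p) = 0] (mod int p)" and G: "[2 * ?c = int K] (mod int p)"
    using kfib_prime_cong[OF assms(1-3)] by (simp_all add: l)
  have "[(2 * ?c) ^ 2 = int K ^ 2] (mod int p)" using G by (rule cong_pow)
  also have "[int K ^ 2 = - 4] (mod int p)" using D by (simp add: cong_iff_dvd_diff)
  finally have "[4 * ?c ^ 2 = 4 * (- 1)] (mod int p)" by (simp add: power_mult_distrib)
  moreover have "coprime 4 (int p)"
    using prime_odd_nat[OF assms(2,3)] coprime_power_left_iff[of 2 2 "int p"] by simp
  ultimately have c: "[?c ^ 2 = - 1] (mod int p)" by (simp only: cong_mult_lcancel)
  have "[int (kfib K (2 * p)) = 0] (mod int p)" "[int (kfib K (Suc (2 * p))) = - 1] (mod int p)"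
    using kfib_double_cong[OF F cong_refl] c cong_trans by blast+
  from kfib_double_cong[OF this] show ?thesis
    by (simp add: returns_mod_def)
qed

text \<open>If the discriminant is a square modulo \<open>p\<close>, then \<open>p - 1\<close>
  returns; otherwise the matrix power at \<open>p + 1\<close> is the scalar -1, and
  \<open>2 * (p + 1)\<close> returns. The common form with \<open>h < p\<close> provides the later
  descent.\<close>

lemma returns_mod_unramified_prime:
  assumes "K \<ge> 1" "prime p" "p > 2" "\<not> p dvd K ^ 2 + 4"
  shows "\<exists>h. 0 < h \<and> h < p \<and> returns_mod K p (4 * h)"
proof -
  have "\<not> int p dvd int K ^ 2 + 4"
    using assms(4) by (metis int_dvd_int_iff of_nat_add of_nat_numeral of_nat_power)
  then have "\<not> [int K ^ 2 + 4 = 0] (mod int p)" by (simp add: cong_0_iff)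
  then have l: "Legendre (int K ^ 2 + 4) (int p) \<in> {1, - 1}" by (simp add: Legendre_def)
  have two: "coprime 2 (int p)" using prime_odd_nat[OF assms(2,3)] by simp
  note FG = kfib_prime_cong[OF assms(1-3)]
  from l consider "Legendre (int K ^ 2 + 4) (int p) = 1" | "Legendre (int K ^ 2 + 4) (int p) = - 1"
    by blast
  then show ?thesis
  proof cases
    case 1
    obtain q where q: "p = Suc q" using assms(3) by (metis not_less_zero not0_implies_Suc)
    have F: "[int (kfib K (Suc q)) = 1] (mod int p)"
      using FG(1) unfolding 1 by (simp add: q)
    have "[2 * int (kfib K (Suc p)) = 2 * int K] (mod int p)"
      using FG(2) unfolding 1 by (simp only: one_add_one mult.commute[of _ 2])
    then have G: "[int (kfib K (Suc p)) = int K] (mod int p)" using two by (simp only: cong_mult_lcancel)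
    have "[int (kfib K (Suc p)) - int K * int (kfib K (Suc q)) = int K - int K * 1] (mod int p)"
      by (intro cong_diff cong_mult cong_refl F G)
    moreover have "int (kfib K (Suc p)) - int K * int (kfib K (Suc q)) = int (kfib K q)"
      by (simp add: q)
    ultimately have "returns_mod K p q" using F by (simp add: returns_mod_def)
    then have "returns_mod K p (4 * q)" by (rule returns_mod_dvd) simp
    then show ?thesis using q assms(3) by (intro exI[of _ q]) auto
  next
    case 2
    then have F: "[int (kfib K p) = - 1] (mod int p)"
      and "[2 * int (kfib K (Suc p)) = 2 * 0] (mod int p)"
      using FG by simp_all
    then have G: "[int (kfib K (Suc p)) = 0] (mod int p)" using two by (simp only: cong_mult_lcancel)
    have "[int K * int (kfib K (Suc p)) + int (kfib K p) = int K * 0 + - 1] (mod int p)"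
      by (intro cong_add cong_mult cong_refl F G)
    then have "[int (kfib K (Suc (Suc p))) = - 1] (mod int p)" by simp
    from kfib_double_cong[OF G this] have "returns_mod K p (2 * Suc p)"
      by (simp add: returns_mod_def)
    moreover obtain h where h: "p = 2 * h + 1"
      using prime_odd_nat[OF assms(2,3)] by (rule oddE)
    \<comment> \<open>As \<open>p\<close> is odd, \<open>Suc h\<close> is half of
      \<open>p + 1\<close>, which is below \<open>p\<close>.\<close>
    moreover have "2 * Suc p = 4 * Suc h" by (simp add: h)
    ultimately have "returns_mod K p (4 * Suc h)" by (simp only:)
    moreover have "Suc h < p" using assms(3) h by simp
    ultimately show ?thesis by blast
  qed
qed

text \<open>Modulo an odd prime dividing \<open>K\<^sup>2 + 4\<close> the characteristic polynomial has the double root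
  \<open>c = K / 2\<close>, which satisfies \<open>c\<^sup>2 = -1\<close> and \<open>F (n + 1) - c F n = c ^ n\<close>.\<close>

lemma four_dvd_returns_mod_ramified:
  assumes "prime p" "p > 2" "p dvd K ^ 2 + 4" "returns_mod K p n"
  shows "4 dvd n"
proof -
  have D: "int p dvd int K ^ 2 + 4"
    using assms(3) by (metis int_dvd_int_iff of_nat_add of_nat_numeral of_nat_power)
  obtain h where h: "p = 2 * h + 1" using prime_odd_nat[OF assms(1,2)] by (rule oddE)
  \<comment> \<open>Since \<open>p = 2 * h + 1\<close>, the number \<open>h + 1\<close> is the
    inverse of 2 modulo \<open>p\<close>, so \<open>c\<close> represents
    \<open>K / 2\<close>.\<close>
  define c where "c = int K * (int h + 1)"
  have "2 * c - int K = int p * int K" by (simp add: c_def h algebra_simps)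
  then have K: "[int K = 2 * c] (mod int p)"
    by (metis cong_iff_dvd_diff cong_sym dvd_triv_left)
  have "[- 4 = int K ^ 2] (mod int p)"
    using D by (metis cong_iff_dvd_diff cong_sym diff_minus_eq_add)
  also have "[int K ^ 2 = (2 * c) ^ 2] (mod int p)" using K by (rule cong_pow)
  finally have "[4 * c ^ 2 = 4 * (- 1)] (mod int p)" by (simp add: power_mult_distrib cong_sym_eq)
  moreover have "coprime 4 (int p)"
    using prime_odd_nat[OF assms(1,2)] coprime_power_left_iff[of 2 2 "int p"] by simp
  ultimately have c2: "[c ^ 2 = - 1] (mod int p)" by (simp only: cong_mult_lcancel)
  have pow: "[int (kfib K (Suc j)) - c * int (kfib K j) = c ^ j] (mod int p)" for j
  proof (induction j)
    case (Suc j)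
    let ?f = "int (kfib K j)" and ?g = "int (kfib K (Suc j))"
    have "[int K * ?g - (- 1) * ?f - c * ?g = 2 * c * ?g - c ^ 2 * ?f - c * ?g] (mod int p)"
      by (intro cong_diff cong_mult cong_refl K cong_sym[OF c2])
    also have "2 * c * ?g - c ^ 2 * ?f - c * ?g = c * (?g - c * ?f)"
      by (simp add: algebra_simps power2_eq_square)
    also have "[\<dots> = c * c ^ j] (mod int p)" by (intro cong_mult cong_refl Suc)
    finally show ?case by simp
  qed simp
  have "[c ^ n = int (kfib K (Suc n)) - c * int (kfib K n)] (mod int p)"
    using pow by (rule cong_sym)
  also have "[int (kfib K (Suc n)) - c * int (kfib K n) = 1 - c * 0] (mod int p)"
    using assms(4) unfolding returns_mod_def by (intro cong_diff cong_mult cong_refl) auto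
  finally have cn: "[c ^ n = 1] (mod int p)" by simp
  have ne: "\<not> [- 1 = 1] (mod int p)"
  proof
    assume "[- 1 = 1] (mod int p)"
    then have "int p dvd 2" by (simp add: cong_iff_dvd_diff)
    then show False using assms(2) zdvd_imp_le by fastforce
  qed
  have "even n" using returns_mod_even assms(2,4) by blast
  then obtain k where k: "n = 2 * k" by (rule evenE)
  have "[(c ^ 2) ^ k = (- 1) ^ k] (mod int p)" using c2 by (rule cong_pow)
  then have "[(- 1) ^ k = 1] (mod int p)"
    using cn by (metis k power_mult cong_sym cong_trans)
  then have "even k" using ne by (cases "even k") auto
  then show ?thesis by (auto simp: k)
qed

section \<open>The primes 2 and 3\<close>

lemma returns_mod_2_even: "even K \<Longrightarrow> returns_mod K 2 2"
  by (auto simp: returns_mod_iff_dvd numeral_2_eq_2 simp flip: of_nat_mult)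

lemma returns_mod_2_odd: "odd K \<Longrightarrow> returns_mod K 2 3"
  by (simp add: returns_mod_iff_dvd numeral_3_eq_3)

lemma returns_mod_3_dvd: "3 dvd K \<Longrightarrow> returns_mod K 3 2"
  by (auto simp: returns_mod_iff_dvd numeral_2_eq_2 elim!: dvdE)

text \<open>Here the square of \<open>K\<close> is 1 modulo 3, which evaluates the polynomials in
  \<open>K\<close> for these two terms. The scalar -1 at index 4 makes 8, but not 4, a return
  time.\<close>

lemma kfib_4_5_mod_3:
  assumes "\<not> 3 dvd K"
  shows "[int (kfib K 4) = 0] (mod int 3)" "[int (kfib K (Suc 4)) = - 1] (mod int 3)"
proof -
  have "[int K ^ 2 = 1] (mod 3)"
  proof -
    have "K = 3 * (K div 3) + 1 \<or> K = 3 * (K div 3) + 2" using assms by presburger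
    then obtain q where "K = 3 * q + 1 \<or> K = 3 * q + 2" by blast
    then have "int K - 1 = 3 * int q \<or> int K - (- 1) = 3 * (int q + 1)" by auto
    then have "[int K = 1] (mod 3) \<or> [int K = - 1] (mod 3)"
      unfolding cong_iff_dvd_diff by (metis dvd_triv_left)
    then show ?thesis using cong_pow[of "int K" 1 3 2] cong_pow[of "int K" "- 1" 3 2] by auto
  qed
  note sq = this
  have "[int K * (int K ^ 2 + 2) = int K * (1 + 2)] (mod 3)"
    by (intro cong_mult cong_add cong_refl sq)
  moreover have "[int K * (1 + 2) = 0] (mod 3)" by (simp add: cong_0_iff)
  moreover have "int (kfib K 4) = int K * (int K ^ 2 + 2)"
    by (simp add: eval_nat_numeral algebra_simps)
  ultimately show "[int (kfib K 4) = 0] (mod int 3)" using cong_trans by fastforce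
  have "[(int K ^ 2) ^ 2 + 3 * int K ^ 2 + 1 = 1 ^ 2 + 3 * 1 + 1] (mod 3)"
    by (intro cong_mult cong_add cong_refl sq cong_pow)
  moreover have "[1 ^ 2 + 3 * 1 + 1 = - 1] (mod (3::int))" by (simp add: cong_def)
  moreover have "int (kfib K (Suc 4)) = (int K ^ 2) ^ 2 + 3 * int K ^ 2 + 1"
    by (simp add: eval_nat_numeral algebra_simps)
  ultimately show "[int (kfib K (Suc 4)) = - 1] (mod int 3)" using cong_trans by fastforce
qed

lemma returns_mod_3_not_dvd: "\<not> 3 dvd K \<Longrightarrow> returns_mod K 3 8"
  using kfib_double_cong[OF kfib_4_5_mod_3] by (simp add: returns_mod_def)

lemma not_returns_mod_3_4: "\<not> 3 dvd K \<Longrightarrow> \<not> returns_mod K 3 4"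
  using kfib_4_5_mod_3(2)[of K] by (auto simp: returns_mod_def cong_def)

text \<open>A positive return time is assembled one prime factor at a time; it guarantees that the
  \<open>LEAST\<close> in \<open>pisano\<close> is attained.\<close>

lemma ex_returns_mod:
  assumes "K \<ge> 1" "m > 0"
  shows "\<exists>n>0. returns_mod K m n"
  using assms(2)
proof (induction m rule: prime_divisors_induct)
  case (unit x)
  then show ?case using returns_mod_1 by auto
next
  case (factor p x)
  then obtain n where n: "n > 0" "returns_mod K x n" by auto
  have "\<exists>c>0. returns_mod K p c"
  proof (cases "p = 2")
    case True
    have "returns_mod K p (if even K then 2 else 3)"
      using True returns_mod_2_even[of K] returns_mod_2_odd[of K] by simp
    then show ?thesis by (intro exI[of _ "if even K then 2 else 3"]) simp
  next
    case False
    then have "p > 2" using prime_ge_2_nat[OF factor(1)] by simp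
    show ?thesis
    proof (cases "p dvd K ^ 2 + 4")
      case True
      then show ?thesis
        using returns_mod_ramified_prime[OF assms(1) factor(1) \<open>p > 2\<close>] \<open>p > 2\<close>
        by (intro exI[of _ "4 * p"]) simp
    next
      case False
      then obtain h where "0 < h" "returns_mod K p (4 * h)"
        using returns_mod_unramified_prime[OF assms(1) factor(1) \<open>p > 2\<close>] by blast
      then show ?thesis by (intro exI[of _ "4 * h"]) simp
    qed
  qed
  then obtain c where c: "c > 0" "returns_mod K p c" by blast
  show ?case
    using returns_mod_prime_step[OF factor(1) c(2) n(2)] c(1) n(1) prime_gt_0_nat[OF factor(1)]
    by (intro exI[of _ "if p dvd x then p * n else c * n"]) simp
qed simp

section \<open>The period as generator of the return times\<close>

lemma pisano_returns:
  assumes "K \<ge> 1" "m > 0"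
  shows "pisano K m > 0" "returns_mod K m (pisano K m)"
proof -
  obtain n where "n > 0" "returns_mod K m n" using ex_returns_mod[OF assms] by blast
  then have "is_period_mod K m n" by (simp add: is_period_mod_iff)
  then have "is_period_mod K m (pisano K m)" unfolding pisano_def by (rule LeastI)
  then show "pisano K m > 0" "returns_mod K m (pisano K m)" by (simp_all add: is_period_mod_iff)
qed

lemma pisano_dvd_iff:
  assumes "K \<ge> 1" "m > 0"
  shows "pisano K m dvd n \<longleftrightarrow> returns_mod K m n"
proof
  assume n: "returns_mod K m n"
  let ?q = "pisano K m"
  have "returns_mod K m (n div ?q * ?q)"
    by (rule returns_mod_mult[OF pisano_returns(2)[OF assms]])
  then have "returns_mod K m (n mod ?q)"
    using n returns_mod_add_iff[of K m "n div ?q * ?q" "n mod ?q"] by (simp only: div_mult_mod_eq)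
  \<comment> \<open>The remainder returns and is smaller than the least period; being no period, it
    can only be 0.\<close>
  moreover have "\<not> is_period_mod K m (n mod ?q)"
    using pisano_returns(1)[OF assms] not_less_Least[of "n mod ?q" "is_period_mod K m"]
    unfolding pisano_def[symmetric] by simp
  ultimately show "?q dvd n" by (auto simp: is_period_mod_iff)
next
  assume "pisano K m dvd n"
  then show "returns_mod K m n" by (rule returns_mod_dvd[OF pisano_returns(2)[OF assms]])
qed

lemma pisano_mono:
  assumes "K \<ge> 1" "m > 0" "d dvd m"
  shows "pisano K d dvd pisano K m"
proof -
  have "d > 0" using assms(2,3) by (rule dvd_pos_nat)
  then show ?thesis
    using returns_mod_divisor[OF pisano_returns(2)[OF assms(1,2)] assms(3)]
    by (simp add: pisano_dvd_iff[OF assms(1)])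
qed

lemma pisano_gt_1:
  assumes "K \<ge> 1" "m > 1"
  shows "pisano K m > 1"
proof (rule ccontr)
  assume "\<not> pisano K m > 1"
  then have "pisano K m = 1" using pisano_returns(1)[of K m] assms by simp
  then have "returns_mod K m 1" using pisano_returns(2)[of K m] assms by simp
  then show False using assms(2) by (simp add: returns_mod_iff_dvd)
qed

lemma pisano_even: "\<lbrakk>K \<ge> 1; m > 2\<rbrakk> \<Longrightarrow> even (pisano K m)"
  by (rule returns_mod_even[OF pisano_returns(2)]) simp_all

lemma pisano_prime_eqI:
  assumes "K \<ge> 1" "m > 1" "prime q" "returns_mod K m q"
  shows "pisano K m = q"
  using assms pisano_gt_1[of K m] pisano_dvd_iff[of K m q]
  by (auto simp: prime_nat_iff)

lemma pisano_2_odd: "\<lbrakk>K \<ge> 1; odd K\<rbrakk> \<Longrightarrow> pisano K 2 = 3"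
  by (simp add: pisano_prime_eqI returns_mod_2_odd)

lemma pisano_3_dvd: "\<lbrakk>K \<ge> 1; 3 dvd K\<rbrakk> \<Longrightarrow> pisano K 3 = 2"
  by (simp add: pisano_prime_eqI returns_mod_3_dvd)

lemma pisano_3_not_dvd:
  assumes "K \<ge> 1" "\<not> 3 dvd K"
  shows "pisano K 3 = 8"
proof -
  have "pisano K 3 dvd 2 ^ 3" "\<not> pisano K 3 dvd 2 ^ 2"
    using returns_mod_3_not_dvd[OF assms(2)] not_returns_mod_3_4[OF assms(2)] assms(1)
    by (simp_all add: pisano_dvd_iff)
  then obtain i where "pisano K 3 = 2 ^ i" "i \<le> 3"
    using divides_primepow_nat[OF two_is_prime_nat] by blast
  moreover from this have "\<not> i \<le> 2"
    using \<open>\<not> pisano K 3 dvd 2 ^ 2\<close> le_imp_power_dvd[of i 2 "2::nat"] by auto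
  ultimately have "i = 3" by simp
  then show ?thesis using \<open>pisano K 3 = 2 ^ i\<close> by simp
qed

lemma four_dvd_pisano:
  assumes "K \<ge> 1" "m > 0" "prime p" "p > 2" "p dvd K ^ 2 + 4" "p dvd m"
  shows "4 dvd pisano K m"
  using four_dvd_returns_mod_ramified[OF assms(3-5)]
    returns_mod_divisor[OF pisano_returns(2)[OF assms(1,2)] assms(6)] .

section \<open>Tame and wild primes\<close>

text \<open>These primes are closed under passing to prime factors of periods. For odd
  \<open>K\<close> the prime 3 is included because 2 has period 3.\<close>

definition tame :: "nat \<Rightarrow> nat \<Rightarrow> bool" where
  "tame K p \<longleftrightarrow> p = 2 \<or> p = 3 \<and> odd K \<or> p dvd K ^ 2 + 4"

definition tame_smooth :: "nat \<Rightarrow> nat \<Rightarrow> bool" where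
  "tame_smooth K m \<longleftrightarrow> m > 0 \<and> (\<forall>p. prime p \<longrightarrow> p dvd m \<longrightarrow> tame K p)"

lemma tame_smooth_1: "tame_smooth K 1"
  by (simp add: tame_smooth_def)

lemma tame_smooth_mult: "\<lbrakk>tame_smooth K a; tame_smooth K b\<rbrakk> \<Longrightarrow> tame_smooth K (a * b)"
  by (auto simp: tame_smooth_def prime_dvd_mult_iff)

lemma tame_smooth_dvd: "\<lbrakk>tame_smooth K a; b dvd a\<rbrakk> \<Longrightarrow> tame_smooth K b"
  unfolding tame_smooth_def by (meson dvd_pos_nat dvd_trans)

lemma tame_smooth_prime: "\<lbrakk>prime p; tame K p\<rbrakk> \<Longrightarrow> tame_smooth K p"
  by (metis tame_smooth_def prime_gt_0_nat primes_dvd_imp_eq)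

lemma tame_smooth_4_power: "tame_smooth K (4 ^ k)"
proof -
  have "tame_smooth K (2 * 2)"
    by (intro tame_smooth_mult tame_smooth_prime two_is_prime_nat) (simp_all add: tame_def)
  then show ?thesis by (induction k) (use tame_smooth_1 tame_smooth_mult in auto)
qed

text \<open>The witnesses are the explicit return times 2 or 3 for the prime 2, 2 or 8 for the prime
  3, and \<open>4 * p\<close> for odd divisors of the discriminant.\<close>

lemma returns_mod_tame_prime:
  assumes "K \<ge> 1" "prime p" "tame K p"
  shows "\<exists>c>0. returns_mod K p c \<and> (\<forall>q. prime q \<longrightarrow> q dvd c \<longrightarrow> q = p \<or> q = 2 \<or> q = 3 \<and> odd K)"
proof -
  have two: "q = 2" if "prime q" "q dvd 2 ^ k" for q k :: nat
    using that prime_dvd_power primes_dvd_imp_eq two_is_prime_nat by blast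
  consider "p = 2" "even K" | "p = 2" "odd K" | "p = 3" "odd K" "3 dvd K"
    | "p = 3" "odd K" "\<not> 3 dvd K" | "p > 2" "p dvd K ^ 2 + 4"
    using assms(3) prime_ge_2_nat[OF assms(2)] unfolding tame_def by force
  then show ?thesis
  proof cases
    case 1
    then show ?thesis using returns_mod_2_even two[of _ 1] by (intro exI[of _ 2]) auto
  next
    case 2
    have "q = 3" if "prime q" "q dvd 3" for q :: nat
      using that by (intro primes_dvd_imp_eq) auto
    then show ?thesis using 2 returns_mod_2_odd by (intro exI[of _ 3]) auto
  next
    case 3
    then show ?thesis using returns_mod_3_dvd two[of _ 1] by (intro exI[of _ 2]) auto
  next
    case 4
    then show ?thesis using returns_mod_3_not_dvd two[of _ 3] by (intro exI[of _ 8]) auto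
  next
    case 5
    have "q = p \<or> q = 2" if "prime q" "q dvd 4 * p" for q
      using that two[of q 2] assms(2) by (auto simp: prime_dvd_mult_iff primes_dvd_imp_eq)
    then show ?thesis
      using 5 returns_mod_ramified_prime[OF assms(1,2)] by (intro exI[of _ "4 * p"]) auto
  qed
qed

lemma returns_mod_tame_smooth:
  assumes "K \<ge> 1" "tame_smooth K m"
  shows "\<exists>n>0. returns_mod K m n \<and> (\<forall>q. prime q \<longrightarrow> q dvd n \<longrightarrow> q dvd m \<or> q = 2 \<or> q = 3 \<and> odd K)"
  using assms(2)
proof (induction m rule: prime_divisors_induct)
  case (unit x)
  then show ?case using returns_mod_1 by (intro exI[of _ 1]) auto
next
  case (factor p x)
  then have "tame_smooth K x" "tame K p"
    by (auto simp: tame_smooth_def)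
  then obtain n where n: "n > 0" "returns_mod K x n"
      "\<forall>q. prime q \<longrightarrow> q dvd n \<longrightarrow> q dvd x \<or> q = 2 \<or> q = 3 \<and> odd K"
    using factor.IH by blast
  obtain c where c: "c > 0" "returns_mod K p c"
      "\<forall>q. prime q \<longrightarrow> q dvd c \<longrightarrow> q = p \<or> q = 2 \<or> q = 3 \<and> odd K"
    using returns_mod_tame_prime[OF assms(1) factor(1) \<open>tame K p\<close>] by blast
  let ?n = "if p dvd x then p * n else c * n"
  have "q dvd p * x \<or> q = 2 \<or> q = 3 \<and> odd K" if "prime q" "q dvd ?n" for q
    using that n(3) c(3) factor(1)
    by (auto simp: prime_dvd_mult_iff split: if_splits dest: primes_dvd_imp_eq)
  moreover have "?n > 0" using n(1) c(1) prime_gt_0_nat[OF factor(1)] by simp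
  ultimately show ?case
    using returns_mod_prime_step[OF factor(1) c(2) n(2)] by blast
qed (simp add: tame_smooth_def)

lemma prime_dvd_pisano_tame_smooth:
  assumes "K \<ge> 1" "tame_smooth K m" "prime q" "q dvd pisano K m"
  shows "q dvd m \<or> q = 2 \<or> q = 3 \<and> odd K"
proof -
  have "m > 0" using assms(2) by (simp add: tame_smooth_def)
  then show ?thesis
    using returns_mod_tame_smooth[OF assms(1,2)] pisano_dvd_iff[OF assms(1)] assms(3,4) dvd_trans
    by blast
qed

lemma tame_smooth_pisano:
  assumes "K \<ge> 1" "tame_smooth K m"
  shows "tame_smooth K (pisano K m)"
proof -
  have "m > 0" using assms(2) by (simp add: tame_smooth_def)
  then show ?thesis
    using prime_dvd_pisano_tame_smooth[OF assms] pisano_returns(1)[OF assms(1)] assms(2)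
    by (auto simp: tame_smooth_def) (auto simp: tame_def)
qed

text \<open>A new wild prime \<open>p\<close> contributes \<open>4 * h\<close> with
  \<open>h < p\<close>, and its 4 is moved to the tame part. A repeated one contributes
  \<open>p\<close>, so strictness is inherited from the remaining factor.\<close>

lemma returns_mod_wild:
  assumes "K \<ge> 1" "h > 0" "\<And>p. prime p \<Longrightarrow> p dvd h \<Longrightarrow> \<not> tame K p"
  shows "\<exists>k h'. 0 < h' \<and> h' \<le> h \<and> (h > 1 \<longrightarrow> h' < h) \<and> returns_mod K h (4 ^ k * h')"
  using assms(2,3)
proof (induction h rule: prime_divisors_induct)
  case (unit x)
  then show ?case using returns_mod_1 by (intro exI[of _ 0] exI[of _ 1]) auto
next
  case (factor p x)
  then have "x > 0" and "\<not> tame K p" by auto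
  moreover have "\<not> tame K q" if "prime q" "q dvd x" for q
    using that factor.prems(2) by simp
  ultimately obtain k h' where h': "0 < h'" "h' \<le> x" "x > 1 \<longrightarrow> h' < x"
      "returns_mod K x (4 ^ k * h')"
    using factor.IH by blast
  have "p > 2" "\<not> p dvd K ^ 2 + 4"
    using \<open>\<not> tame K p\<close> prime_ge_2_nat[OF factor(1)] by (auto simp: tame_def le_less)
  then obtain h where h: "0 < h" "h < p" "returns_mod K p (4 * h)"
    using returns_mod_unramified_prime[OF assms(1) factor(1)] by blast
  note step = returns_mod_prime_step[OF factor(1) h(3) h'(4)]
  show ?case
  proof (cases "p dvd x")
    case True
    then have "x > 1" using \<open>p > 2\<close> dvd_imp_le[OF _ \<open>x > 0\<close>, of p] by simp
    then have "p * h' < p * x" using h' \<open>p > 2\<close> by simp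
    moreover have "returns_mod K (p * x) (4 ^ k * (p * h'))"
      using step True by (simp add: mult.left_commute)
    moreover have "0 < p * h'" using h' \<open>p > 2\<close> by simp
    ultimately show ?thesis by (intro exI[of _ k] exI[of _ "p * h'"]) simp
  next
    case False
    have "h * h' < p * x" using h h' \<open>x > 0\<close> by (intro mult_less_le_imp_less) auto
    moreover have "returns_mod K (p * x) (4 ^ Suc k * (h * h'))"
      using step False by (simp add: mult_ac)
    moreover have "0 < h * h'" using h h' by simp
    ultimately show ?thesis by (intro exI[of _ "Suc k"] exI[of _ "h * h'"]) simp
  qed
qed simp

text \<open>The wild part of the iterates decreases: a wild prime \<open>p\<close> is replaced by \<open>p - 1\<close> or by
  \<open>(p + 1) / 2\<close>, up to powers of two.\<close>

lemma pisano_iterate_tame_smooth_aux: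
  assumes "K \<ge> 1"
  shows "\<lbrakk>h > 0; tame_smooth K g; m dvd g * h\<rbrakk> \<Longrightarrow> \<exists>N. tame_smooth K ((pisano K ^^ N) m)"
proof (induction h arbitrary: g m rule: less_induct)
  case (less h)
  have "g > 0" using less.prems(2) by (simp add: tame_smooth_def)
  then have "m > 0" using less.prems(1,3) dvd_pos_nat[of "g * h" m] by simp
  have "h = 1 \<or> h > 1" using less.prems(1) by linarith
  then consider p where "prime p" "p dvd h" "tame K p" | "h = 1"
    | "h > 1" "\<And>p. prime p \<Longrightarrow> p dvd h \<Longrightarrow> \<not> tame K p"
    by blast
  then show ?case
  proof cases
    \<comment> \<open>A tame prime factor of \<open>h\<close> is moved into \<open>g\<close>, which
      makes \<open>h\<close> smaller without changing the product.\<close>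
    case 1
    then obtain h1 where h1: "h = p * h1" by (auto elim: dvdE)
    then have "0 < h1" "h1 < h" using less.prems(1) prime_gt_1_nat[OF 1(1)] by auto
    moreover have "tame_smooth K (g * p)"
      by (rule tame_smooth_mult[OF less.prems(2) tame_smooth_prime[OF 1(1,3)]])
    moreover have "m dvd g * p * h1" using less.prems(3) by (simp add: h1 mult.assoc)
    ultimately show ?thesis by (intro less.IH)
  next
    case 2
    then have "tame_smooth K m" using less.prems tame_smooth_dvd by simp
    then show ?thesis by (intro exI[of _ 0]) simp
  next
    case 3
    obtain k h' where h': "0 < h'" "h' < h" "returns_mod K h (4 ^ k * h')"
      using returns_mod_wild[OF assms less.prems(1) 3(2)] 3(1) by blast
    \<comment> \<open>All primes of \<open>g\<close> are tame and all primes of \<open>h\<close> are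
      wild.\<close>
    have "coprime g h"
    proof (rule ccontr)
      assume "\<not> coprime g h"
      then have "gcd g h \<noteq> 1" unfolding coprime_iff_gcd_eq_1 .
      then obtain p where "prime p" "p dvd gcd g h"
        using prime_factor_nat by blast
      then show False using 3(2) less.prems(2) by (auto simp: tame_smooth_def)
    qed
    let ?g = "pisano K g * 4 ^ k"
    have "returns_mod K g (?g * h')"
      by (rule returns_mod_dvd[OF pisano_returns(2)[OF assms \<open>g > 0\<close>]]) simp
    moreover have "returns_mod K h (?g * h')"
      by (rule returns_mod_dvd[OF h'(3)]) simp
    ultimately have "returns_mod K (g * h) (?g * h')"
      using \<open>coprime g h\<close> by (rule returns_mod_coprime)
    \<comment> \<open>The period is known only up to divisibility, which is why the induction is
      over all \<open>m\<close> dividing \<open>g * h\<close>.\<close>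
    then have "pisano K m dvd ?g * h'"
      using less.prems(3) \<open>m > 0\<close> assms by (simp add: pisano_dvd_iff returns_mod_divisor)
    moreover have "tame_smooth K ?g"
      using less.prems(2) assms by (intro tame_smooth_mult tame_smooth_4_power tame_smooth_pisano)
    ultimately obtain N where "tame_smooth K ((pisano K ^^ N) (pisano K m))"
      using less.IH[OF h'(2,1)] by blast
    then show ?thesis by (intro exI[of _ "Suc N"]) (simp only: funpow_Suc_right o_apply)
  qed
qed

lemma pisano_iterate_tame_smooth:
  assumes "K \<ge> 1" "m > 0"
  shows "\<exists>N. tame_smooth K ((pisano K ^^ N) m)"
  using pisano_iterate_tame_smooth_aux[OF assms tame_smooth_1] by simp

section \<open>Reaching a fixed point\<close>

text \<open>The conditions make room for the return times of the tame primes: 4 for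
  \<open>4 * p\<close>, 6 for the interplay of 2 and 3 when \<open>K\<close> is odd, and 8 for the
  return time of 3 when 3 does not divide \<open>K\<close>.\<close>

definition stable_class :: "nat \<Rightarrow> nat \<Rightarrow> bool" where
  "stable_class K m \<longleftrightarrow> m > 1 \<and> tame_smooth K m \<and>
     (\<forall>p. prime p \<longrightarrow> p > 2 \<longrightarrow> p dvd K ^ 2 + 4 \<longrightarrow> p dvd m \<longrightarrow> 4 dvd m) \<and>
     (odd K \<longrightarrow> 6 dvd m) \<and> (odd K \<longrightarrow> \<not> 3 dvd K \<longrightarrow> 8 dvd m)"

text \<open>Lifting from \<open>p\<close> multiplies \<open>c\<close> by one factor \<open>p\<close>
  less than the exponent. The missing factor is the one allowed in \<open>c dvd p * u\<close>, and
  the coprime part \<open>u\<close> fits into \<open>m\<close> separately.\<close>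

lemma returns_mod_prime_power_self:
  assumes "prime p" "m > 0" "p dvd m" "returns_mod K p c" "c dvd p * u" "u dvd m" "coprime p u"
  shows "returns_mod K (p ^ multiplicity p m) m"
proof -
  have "multiplicity p m > 0" using assms(1-3) by (simp add: prime_multiplicity_gt_zero_iff)
  then obtain v where v: "multiplicity p m = Suc v" using gr0_implies_Suc by blast
  have "p ^ v * c dvd p ^ v * (p * u)" using assms(5) by simp
  also have "p ^ v * (p * u) = p ^ multiplicity p m * u" by (simp add: v)
  also have "p ^ multiplicity p m * u dvd m"
    using assms(6,7) by (intro divides_mult) (auto simp: multiplicity_dvd)
  finally show ?thesis
    unfolding v by (rule returns_mod_dvd[OF returns_mod_prime_power[OF assms(1,4)]])
qed

lemma stable_class_returns:
  assumes "K \<ge> 1" "stable_class K m"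
  shows "returns_mod K m m"
proof (rule returns_mod_prime_powers)
  show m: "m > 0" using assms(2) by (simp add: stable_class_def)
  have sm: "tame_smooth K m"
    and four: "\<And>p. \<lbrakk>prime p; p > 2; p dvd K ^ 2 + 4; p dvd m\<rbrakk> \<Longrightarrow> 4 dvd m"
    and six: "odd K \<Longrightarrow> 6 dvd m" and eight: "\<lbrakk>odd K; \<not> 3 dvd K\<rbrakk> \<Longrightarrow> 8 dvd m"
    using assms(2) unfolding stable_class_def by blast+
  fix p assume p: "prime p" "p dvd m"
  note self = returns_mod_prime_power_self[OF p(1) m p(2)]
  have "tame K p" using sm p by (simp add: tame_smooth_def)
  then consider "p = 2" "even K" | "p = 2" "odd K" | "p = 3" "odd K" "3 dvd K"
    | "p = 3" "odd K" "\<not> 3 dvd K" | "p > 2" "p dvd K ^ 2 + 4"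
    using prime_ge_2_nat[OF p(1)] unfolding tame_def by force
  then show "returns_mod K (p ^ multiplicity p m) m"
  \<comment> \<open>In each case \<open>self\<close> is instantiated with a return time of
    \<open>p\<close> and a cofactor coprime to \<open>p\<close>.\<close>
  proof cases
    case 1
    then show ?thesis by (intro self[of K 2 1]) (simp_all add: returns_mod_2_even)
  next
    case 2
    then have "3 dvd m" using six dvd_trans[of 3 6 m] by simp
    then show ?thesis using 2 by (intro self[of K 3 3]) (simp_all add: returns_mod_2_odd)
  next
    case 3
    then have "2 dvd m" using six dvd_trans[of 2 6 m] by simp
    then show ?thesis using 3 by (intro self[of K 2 2]) (simp_all add: returns_mod_3_dvd)
  next
    case 4
    have "coprime 3 (8::nat)" using coprime_power_right_iff[of 3 "2::nat" 3] by simp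
    then show ?thesis using 4 eight by (intro self[of K 8 8]) (simp_all add: returns_mod_3_not_dvd)
  next
    case 5
    have "coprime p 4"
      using prime_odd_nat[OF p(1) 5(1)] coprime_power_right_iff[of p 2 2] by simp
    then show ?thesis
      using 5 four p returns_mod_ramified_prime[OF assms(1) p(1)]
      by (intro self[of K "4 * p" 4]) (simp_all add: mult.commute)
  qed
qed

lemma three_dvd_pisano:
  assumes "K \<ge> 1" "odd K" "m > 0" "2 dvd m"
  shows "3 dvd pisano K m"
  using pisano_mono[OF assms(1,3,4)] pisano_2_odd[OF assms(1,2)] by simp

lemma eight_dvd_pisano:
  assumes "K \<ge> 1" "\<not> 3 dvd K" "m > 0" "3 dvd m"
  shows "8 dvd pisano K m"
  using pisano_mono[OF assms(1,3,4)] pisano_3_not_dvd[OF assms(1,2)] by simp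

lemma six_dvd_pisano:
  assumes "K \<ge> 1" "odd K" "m > 2" "2 dvd m"
  shows "6 dvd pisano K m"
proof -
  have "2 dvd pisano K m" "3 dvd pisano K m"
    using assms pisano_even three_dvd_pisano by simp_all
  then show ?thesis by presburger
qed

text \<open>The period divides \<open>m\<close>, so its primes already divide \<open>m\<close>; and
  the primes of \<open>m\<close> force the required powers of 2 and 3 into the period.\<close>

lemma stable_class_pisano:
  assumes "K \<ge> 1" "stable_class K m"
  shows "pisano K m dvd m" "stable_class K (pisano K m)"
proof -
  have m: "m > 1" and sm: "tame_smooth K m" and six: "odd K \<Longrightarrow> 6 dvd m"
    using assms(2) by (auto simp: stable_class_def)
  show d: "pisano K m dvd m"
    using stable_class_returns[OF assms] m assms(1) by (simp add: pisano_dvd_iff)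
  have "4 dvd pisano K m"
    if "prime p" "p > 2" "p dvd K ^ 2 + 4" "p dvd pisano K m" for p
    using that m d assms(1) four_dvd_pisano[of K m p] dvd_trans by auto
  moreover have "6 dvd pisano K m" if "odd K"
  proof -
    have "m > 2" using six[OF that] m by (auto dest: dvd_imp_le)
    moreover have "2 dvd m" using six[OF that] dvd_trans[of 2 6 m] by simp
    ultimately show ?thesis using six_dvd_pisano assms(1) that by simp
  qed
  moreover have "8 dvd pisano K m" if "odd K" "\<not> 3 dvd K"
    using eight_dvd_pisano[OF assms(1) that(2), of m] m six[OF that(1)] dvd_trans[of 3 6 m] by simp
  ultimately show "stable_class K (pisano K m)"
    unfolding stable_class_def
    using tame_smooth_pisano[OF assms(1) sm] pisano_gt_1[OF assms(1) m] by blast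
qed

text \<open>Each iterate divides the previous one, so it either decreases or is fixed.\<close>

lemma stable_class_fixed_point:
  assumes "K \<ge> 1" "stable_class K m"
  shows "\<exists>N. pisano_fixed_point K ((pisano K ^^ N) m)"
  using assms(2)
proof (induction m rule: less_induct)
  case (less m)
  note props = stable_class_pisano[OF assms(1) less.prems]
  have m: "m > 1" using less.prems by (simp add: stable_class_def)
  show ?case
  proof (cases "pisano K m = m")
    case True
    then show ?thesis using m by (intro exI[of _ 0]) (simp add: pisano_fixed_point_def)
  next
    case False
    moreover have "pisano K m \<le> m" using props(1) m by (intro dvd_imp_le) auto
    ultimately obtain N where "pisano_fixed_point K ((pisano K ^^ N) (pisano K m))"
      using less.IH[OF _ props(2)] by auto
    then show ?thesis by (intro exI[of _ "Suc N"]) (simp only: funpow_Suc_right o_apply)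
  qed
qed

section \<open>From tame numbers to the stable class or to the cycle of 2 and 3\<close>

definition settles :: "nat \<Rightarrow> nat \<Rightarrow> bool" where
  "settles K m \<longleftrightarrow> (\<exists>N. pisano_fixed_point K ((pisano K ^^ N) m) \<or>
     [K = 3] (mod 6) \<and> (pisano K ^^ N) m \<in> {2, 3})"

lemma settles_iterate:
  assumes "settles K ((pisano K ^^ N) m)"
  shows "settles K m"
proof -
  obtain M where "pisano_fixed_point K ((pisano K ^^ (M + N)) m) \<or>
      [K = 3] (mod 6) \<and> (pisano K ^^ (M + N)) m \<in> {2, 3}"
    using assms unfolding settles_def funpow_add o_apply by blast
  then show ?thesis unfolding settles_def by blast
qed

lemma settles_pisano: "settles K (pisano K m) \<Longrightarrow> settles K m"
  using settles_iterate[of K 1 m] by simp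

lemma settles_stable_class: "\<lbrakk>K \<ge> 1; stable_class K m\<rbrakk> \<Longrightarrow> settles K m"
  unfolding settles_def using stable_class_fixed_point by blast

lemma settles_2_3: "\<lbrakk>[K = 3] (mod 6); m \<in> {2, 3}\<rbrakk> \<Longrightarrow> settles K m"
  unfolding settles_def by (intro exI[of _ 0]) simp

text \<open>One step suffices: an odd prime of the period that divides the discriminant already
  divides \<open>m\<close>, and there it forces 4 into the period.\<close>

lemma settles_even:
  assumes "K \<ge> 1" "even K" "tame_smooth K m" "m > 1"
  shows "settles K m"
proof (rule settles_pisano, rule settles_stable_class[OF assms(1)])
  have "4 dvd pisano K m"
    if "prime p" "p > 2" "p dvd K ^ 2 + 4" "p dvd pisano K m" for p
    using prime_dvd_pisano_tame_smooth[OF assms(1,3) that(1,4)] that(2) assms(2,4)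
      four_dvd_pisano[OF assms(1) _ that(1-3), of m] by auto
  then show "stable_class K (pisano K m)"
    unfolding stable_class_def
    using tame_smooth_pisano[OF assms(1,3)] pisano_gt_1[OF assms(1,4)] assms(2) by blast
qed

lemma tame_smooth_odd_cases:
  assumes "odd K" "tame_smooth K m" "m > 1"
  obtains "2 dvd m" | "3 dvd m" | p where "prime p" "p > 2" "p dvd K ^ 2 + 4" "p dvd m"
proof -
  obtain p where p: "prime p" "p dvd m" using prime_factor_nat[of m] assms(3) by auto
  then have "tame K p" using assms(2) by (simp add: tame_smooth_def)
  then consider "p = 2" | "p = 3" | "p > 2" "p dvd K ^ 2 + 4"
    using prime_ge_2_nat[OF p(1)] unfolding tame_def by linarith
  then show thesis using p that by cases blast+
qed

text \<open>Odd divisors of the discriminant force an even period, 2 forces 3, 3 forces 8, and an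
  even number above 2 forces 6. So some iterate is a multiple of 6, and its period is a multiple of
  24 in the stable class.\<close>

lemma settles_odd_not_3_dvd:
  assumes "K \<ge> 1" "odd K" "\<not> 3 dvd K" "tame_smooth K m" "m > 1"
  shows "settles K m"
proof -
  have six: "settles K m" if m: "tame_smooth K m" "m > 1" "6 dvd m" for m
  proof (rule settles_pisano, rule settles_stable_class[OF assms(1)])
    have "2 dvd m" "3 dvd m" using m(3) by presburger+
    then have "3 dvd pisano K m" "8 dvd pisano K m"
      using three_dvd_pisano[OF assms(1,2)] eight_dvd_pisano[OF assms(1,3)] m(2) by simp_all
    then have "4 dvd pisano K m" "6 dvd pisano K m" by presburger+
    then show "stable_class K (pisano K m)"
      unfolding stable_class_def
      using tame_smooth_pisano[OF assms(1) m(1)] pisano_gt_1[OF assms(1) m(2)]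
        \<open>8 dvd pisano K m\<close> by blast
  qed
  have three: "settles K m" if m: "tame_smooth K m" "m > 1" "3 dvd m" for m
  proof (rule settles_pisano, rule settles_pisano, rule six)
    have "8 dvd pisano K m" using eight_dvd_pisano[OF assms(1,3)] m by simp
    moreover have "pisano K m > 0" using pisano_gt_1[OF assms(1) m(2)] by simp
    ultimately have "2 dvd pisano K m" "pisano K m > 2" by presburger+
    then show "6 dvd pisano K (pisano K m)" by (rule six_dvd_pisano[OF assms(1,2), rotated])
  qed (use m tame_smooth_pisano pisano_gt_1 assms(1) in auto)
  have two: "settles K m" if m: "tame_smooth K m" "m > 1" "2 dvd m" for m
    by (rule settles_pisano, rule three)
      (use m tame_smooth_pisano pisano_gt_1 three_dvd_pisano assms(1,2) in auto)
  show ?thesis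
    using tame_smooth_odd_cases[OF assms(2,4,5)]
  proof cases
    case (3 p)
    then have "4 dvd pisano K m" using four_dvd_pisano assms(1,5) by simp
    then have "2 dvd pisano K m" by presburger
    then show ?thesis
      by (rule settles_pisano[OF two[rotated 2]])
        (use tame_smooth_pisano pisano_gt_1 assms(1,4,5) in auto)
  qed (use two three assms(4,5) in blast)+
qed

text \<open>Every \<open>m\<close> is even or has an even period. An even number other than 2 has a
  period divisible by 6; such a number is stable, or an odd prime of the discriminant dividing it
  makes the next period a stable multiple of 12. Only 2 escapes, into the cycle.\<close>

lemma settles_odd_3_dvd:
  assumes "K \<ge> 1" "odd K" "3 dvd K" "tame_smooth K m" "m > 1"
  shows "settles K m"
proof -
  have K: "[K = 3] (mod 6)" using assms(2,3) unfolding cong_def by presburger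
  have twelve: "settles K m" if m: "tame_smooth K m" "m > 1" "4 dvd m" "3 dvd m" for m
  proof (rule settles_stable_class[OF assms(1)])
    have "6 dvd m" using m(3,4) by presburger
    then show "stable_class K m" unfolding stable_class_def using m assms(3) by blast
  qed
  have six: "settles K m" if m: "tame_smooth K m" "m > 1" "6 dvd m" for m
  proof (cases "\<exists>p. prime p \<and> p > 2 \<and> p dvd K ^ 2 + 4 \<and> p dvd m")
    case True
    then have "4 dvd pisano K m" using four_dvd_pisano assms(1) m(2) by auto
    moreover have "2 dvd m" using m(3) by presburger
    then have "3 dvd pisano K m" using three_dvd_pisano[OF assms(1,2)] m(2) by simp
    ultimately show ?thesis
      by (intro settles_pisano[OF twelve] tame_smooth_pisano pisano_gt_1 assms(1) m)
  next
    case False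
    then have "stable_class K m" unfolding stable_class_def using m assms(3) by blast
    then show ?thesis by (rule settles_stable_class[OF assms(1)])
  qed
  have two: "settles K m" if m: "tame_smooth K m" "m > 1" "2 dvd m" for m
  proof (cases "m = 2")
    case True
    then show ?thesis using settles_2_3[OF K] by simp
  next
    case False
    then have "m > 2" using m(2) by simp
    then show ?thesis
      using six_dvd_pisano[OF assms(1,2) _ m(3)]
      by (intro settles_pisano[OF six] tame_smooth_pisano pisano_gt_1 assms(1) m)
  qed
  show ?thesis
    using tame_smooth_odd_cases[OF assms(2,4,5)]
  proof cases
    case 1
    then show ?thesis using two assms(4,5) by simp
  next
    case 2
    then have "m > 2" using assms(5) dvd_imp_le[of 3 m] by simp
    then have "even (pisano K m)" by (rule pisano_even[OF assms(1)])
    then show ?thesis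
      by (intro settles_pisano[OF two] tame_smooth_pisano pisano_gt_1 assms)
  next
    case (3 p)
    then have "4 dvd pisano K m" using four_dvd_pisano assms(1,5) by simp
    then have "even (pisano K m)" by presburger
    then show ?thesis
      by (intro settles_pisano[OF two] tame_smooth_pisano pisano_gt_1 assms)
  qed
qed

lemma pisano_iterate_gt_1:
  assumes "K \<ge> 1" "m > 1"
  shows "(pisano K ^^ N) m > 1"
  by (induction N) (use assms pisano_gt_1 in auto)

theorem theorem1p6:
  fixes K :: nat
  assumes "K \<ge> 1"
  shows "(\<forall>m>1. \<exists>N.
            pisano_fixed_point K ((pisano K ^^ N) m) \<or>
            ([K = 3] (mod 6) \<and> (pisano K ^^ N) m \<in> {2, 3}))
       \<and> ([K = 3] (mod 6) \<longrightarrow>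
            pisano K 2 = 3 \<and> pisano K 3 = 2 \<and>
            periodic_point (pisano K) 2 2 \<and> periodic_point (pisano K) 2 3)"
proof (intro conjI allI impI)
  fix m :: nat assume m: "m > 1"
  obtain N where N: "tame_smooth K ((pisano K ^^ N) m)"
    using pisano_iterate_tame_smooth[OF assms, of m] m by auto
  \<comment> \<open>The parity of \<open>K\<close> and its divisibility by 3 select the applicable
    case.\<close>
  have "settles K ((pisano K ^^ N) m)"
    using settles_even[OF assms _ N] settles_odd_not_3_dvd[OF assms _ _ N]
      settles_odd_3_dvd[OF assms _ _ N] pisano_iterate_gt_1[OF assms m] by blast
  then have "settles K m" by (rule settles_iterate)
  then show "\<exists>N. pisano_fixed_point K ((pisano K ^^ N) m) \<or>
      ([K = 3] (mod 6) \<and> (pisano K ^^ N) m \<in> {2, 3})"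
    unfolding settles_def .
next
  assume "[K = 3] (mod 6)"
  then have "odd K" "3 dvd K" unfolding cong_def by presburger+
  then show p2: "pisano K 2 = 3" and p3: "pisano K 3 = 2"
    using assms by (simp_all add: pisano_2_odd pisano_3_dvd)
  have one: "0 < i \<and> i < 2 \<longleftrightarrow> i = 1" for i :: nat by auto
  have two: "(pisano K ^^ 2) x = pisano K (pisano K x)" for x by (simp add: numeral_2_eq_2)
  show "periodic_point (pisano K) 2 2" "periodic_point (pisano K) 2 3"
    unfolding periodic_point_def one two by (simp_all add: p2 p3)
qed

end
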